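(* Any rotational surface $S_\alpha$ with generatrix curve $\alpha=(x,z)$, $x$ being non-constant, is uniquely determined, up to translations in the $z$-direction, by the geometric linear momentum $\mathcal K=\mathcal K(x)$ of its generatrix curve. That is, if two rotational surfaces around the $z$-axis have generatrix curves with the same geometric linear momentum as a function of $x$ (on the same interval of values of $x$), then they differ by a translation along the $z$-axis.
   Context: Rotational surfaces: let $\alpha(s)=(x(s),z(s))$, $s\in I\subseteq\mathbb{R}$, be a smooth curve in the $xz$-plane parametrized by arc length, with $x>0$. The rotational surface $S_\alpha\subset\mathbb{R}^3$ is generated by rotating $\alpha$ around the $z$-axis: $X(s,\theta)=(x(s)\cos\theta,x(s)\sin\theta,z(s))$. The geometric linear momentum of $\alpha$ (with respect to the $z$-axis) is $\mathcal K(s)=\langle\dot\alpha(s),(0,1)\rangle=\dot z(s)$. When $x$ is non-constant one works on arcs where $\dot x\neq0$, oriented so that $\dot x=\sqrt{1-\mathcal K^2}>0$; then $s$ can be expressed as a function of $x$ and $\mathcal K=\mathcal K(x)$, with values in $(-1,1)$, is regarded as a function of $x$. *)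

theory Defs
  imports "HOL-Analysis.Analysis"
begin

text \<open>
  Derivatives are taken within the parameter interval \<open>I\<close>, so that \<open>I\<close> may contain endpoints;
  there they are one-sided.
\<close>

definition smooth_curve_on :: "real set \<Rightarrow> (real \<Rightarrow> 'a::real_normed_vector) \<Rightarrow> bool" where
  "smooth_curve_on I f \<longleftrightarrow>
     (\<exists>D :: nat \<Rightarrow> real \<Rightarrow> 'a. D 0 = f \<and>
        (\<forall>n. \<forall>s\<in>I. (D n has_vector_derivative D (Suc n) s) (at s within I)))"

definition velocity :: "real set \<Rightarrow> (real \<Rightarrow> real \<times> real) \<Rightarrow> real \<Rightarrow> real \<times> real" where
  "velocity I \<alpha> s = vector_derivative \<alpha> (at s within I)"

text \<open>A pair \<open>\<alpha> s = (x s, z s)\<close> is a point of the \<open>xz\<close>-plane.\<close>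

definition generatrix :: "real set \<Rightarrow> (real \<Rightarrow> real \<times> real) \<Rightarrow> bool" where
  "generatrix I \<alpha> \<longleftrightarrow>
     is_interval I \<and> interior I \<noteq> {} \<and> smooth_curve_on I \<alpha> \<and>
     (\<forall>s\<in>I. norm (velocity I \<alpha> s) = 1) \<and> (\<forall>s\<in>I. fst (\<alpha> s) > 0)"

text \<open>
  The arcs on which the momentum can be regarded as a function of \<open>x\<close>. The orientation has to be
  fixed: traversing an arc backwards replaces the momentum by its negative.
\<close>

definition x_increasing :: "real set \<Rightarrow> (real \<Rightarrow> real \<times> real) \<Rightarrow> bool" where
  "x_increasing I \<alpha> \<longleftrightarrow> (\<forall>s\<in>I. fst (velocity I \<alpha> s) > 0)"

definition x_values :: "real set \<Rightarrow> (real \<Rightarrow> real \<times> real) \<Rightarrow> real set" where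
  "x_values I \<alpha> = (\<lambda>s. fst (\<alpha> s)) ` I"

definition momentum :: "real set \<Rightarrow> (real \<Rightarrow> real \<times> real) \<Rightarrow> real \<Rightarrow> real" where
  "momentum I \<alpha> s = velocity I \<alpha> s \<bullet> (0, 1)"

text \<open>
  The momentum as a function of \<open>x\<close>; meaningful for \<open>r \<in> x_values I \<alpha>\<close> when \<open>x\<close> is injective
  on \<open>I\<close>, in particular when \<open>x_increasing I \<alpha>\<close>.
\<close>

definition momentum_of_x :: "real set \<Rightarrow> (real \<Rightarrow> real \<times> real) \<Rightarrow> real \<Rightarrow> real" where
  "momentum_of_x I \<alpha> r = momentum I \<alpha> (the_inv_into I (\<lambda>s. fst (\<alpha> s)) r)"

definition rotational_param :: "(real \<Rightarrow> real \<times> real) \<Rightarrow> real \<Rightarrow> real \<Rightarrow> real ^ 3" where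
  "rotational_param \<alpha> s \<theta> = vector [fst (\<alpha> s) * cos \<theta>, fst (\<alpha> s) * sin \<theta>, snd (\<alpha> s)]"

definition rotational_surface :: "real set \<Rightarrow> (real \<Rightarrow> real \<times> real) \<Rightarrow> (real ^ 3) set" where
  "rotational_surface I \<alpha> = {rotational_param \<alpha> s \<theta> | s \<theta>. s \<in> I}"

end

theory Submission
  imports Defs
begin

text \<open>
  Where \<open>x\<close> increases strictly, the generatrix is the graph \<open>z = h(x)\<close> of a height function over the
  interval of values of \<open>x\<close>, and the surface is determined by \<open>h\<close>. For unit speed, with
  \<open>\<K> = dz/ds\<close>, the other velocity component is \<open>dx/ds = sqrt (1 - \<K>\<^sup>2)\<close>, so
  \<open>dh/dx = \<K> / sqrt (1 - \<K>\<^sup>2)\<close> (\<open>height_has_derivative\<close>). The right-hand side involves only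
  the momentum as a function of \<open>x\<close>. Two curves with the same momentum thus have height functions
  with the same derivative on the same interval; these differ by a constant, which is the vertical
  translation carrying one surface onto the other.
\<close>

text \<open>
  Derivatives are one-sided at endpoints of the interval, so the mean value theorem is used on the
  segment between two points, with the derivative restricted to that segment.
\<close>

lemma pos_derivative_within_imp_strict_mono_on:
  fixes f :: "real \<Rightarrow> real"
  assumes "is_interval I"
    and deriv: "\<And>s. s \<in> I \<Longrightarrow> (f has_real_derivative f' s) (at s within I)"
    and pos: "\<And>s. s \<in> I \<Longrightarrow> f' s > 0"
  shows "strict_mono_on I f"
proof (rule strict_mono_onI)
  fix a b assume ab: "a \<in> I" "b \<in> I" "a < b"
  have sub: "{a..b} \<subseteq> I"
    using mem_is_interval_1_I[OF assms(1) ab(1,2)] by (simp add: subset_iff)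
  have "\<exists>t\<in>{a<..<b}. f b - f a = f' t * (b - a)"
  proof (rule mvt_simple[OF \<open>a < b\<close>])
    fix t assume "a \<le> t" "t \<le> b"
    with sub have "t \<in> I"
      by auto
    then have "(f has_real_derivative f' t) (at t within {a..b})"
      by (rule DERIV_subset[OF deriv sub])
    then show "(f has_derivative (*) (f' t)) (at t within {a..b})"
      by (simp add: has_field_derivative_def)
  qed
  then obtain t where t: "t \<in> {a<..<b}" "f b - f a = f' t * (b - a)"
    by blast
  have "f' t > 0"
    using t(1) sub by (intro pos) auto
  with \<open>a < b\<close> have "f' t * (b - a) > 0"
    by simp
  with t(2) show "f a < f b"
    by simp
qed

text \<open>
  A continuous injective real function on an interval is a homeomorphism onto its image, which
  supplies the continuity of the inverse that the inverse function rule asks for.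
\<close>

lemma has_derivative_the_inv_into_interval:
  fixes f :: "real \<Rightarrow> real"
  assumes I: "is_interval I"
    and deriv: "\<And>s. s \<in> I \<Longrightarrow> (f has_real_derivative f' s) (at s within I)"
    and pos: "\<And>s. s \<in> I \<Longrightarrow> f' s > 0"
    and a: "a \<in> I"
  shows "(the_inv_into I f has_real_derivative inverse (f' a)) (at (f a) within f ` I)"
proof -
  have inj: "inj_on f I"
    using pos_derivative_within_imp_strict_mono_on[OF I deriv pos] strict_mono_on_imp_inj_on by blast
  have cont: "continuous_on I f"
    using deriv by (rule DERIV_continuous_on)
  obtain g where g: "homeomorphism I (f ` I) f g"
    using injective_into_1d_eq_homeomorphism[OF cont] inj I is_interval_path_connected by blast
  have "continuous_on (f ` I) (the_inv_into I f)"
  proof (subst continuous_on_cong[OF refl])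
    show "continuous_on (f ` I) g"
      using g by (simp add: homeomorphism_def)
    show "the_inv_into I f r = g r" if "r \<in> f ` I" for r
      using that g the_inv_into_f_f[OF inj] by (auto simp: homeomorphism_def)
  qed
  then have "continuous (at (f a) within f ` I) (the_inv_into I f)"
    using a by (simp add: continuous_on_eq_continuous_within)
  then have "(the_inv_into I f has_derivative (*) (inverse (f' a))) (at (f a) within f ` I)"
  proof (rule has_derivative_inverse_within[rotated])
    show "(f has_derivative (*) (f' a)) (at a within I)"
      using deriv[OF a] by (simp add: has_field_derivative_def)
    show "linear ((*) (inverse (f' a)))"
      by (simp add: bounded_linear.linear bounded_linear_mult_right)
    show "(*) (inverse (f' a)) \<circ> (*) (f' a) = id"
      using pos[OF a] by (auto simp: fun_eq_iff field_simps)
  qed (use a the_inv_into_f_f[OF inj] in auto)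
  then show ?thesis
    by (simp add: has_field_derivative_def)
qed

text \<open>Meaningful for \<open>r \<in> x_values I \<alpha>\<close> when \<open>x\<close> is injective on \<open>I\<close>.\<close>

definition height_of_x :: "real set \<Rightarrow> (real \<Rightarrow> real \<times> real) \<Rightarrow> real \<Rightarrow> real" where
  "height_of_x I \<alpha> r = snd (\<alpha> (the_inv_into I (\<lambda>s. fst (\<alpha> s)) r))"

lemma generatrix_has_velocity:
  assumes "generatrix I \<alpha>" and "s \<in> I"
  shows "(\<alpha> has_vector_derivative velocity I \<alpha> s) (at s within I)"
proof -
  obtain D where "D 0 = \<alpha>" "\<forall>n. \<forall>s\<in>I. (D n has_vector_derivative D (Suc n) s) (at s within I)"
    using assms(1) unfolding generatrix_def smooth_curve_on_def by blast
  then have "(\<alpha> has_vector_derivative D (Suc 0) s) (at s within I)"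
    using assms(2) by force
  then have "\<alpha> differentiable (at s within I)"
    by (rule differentiableI_vector)
  then show ?thesis
    unfolding velocity_def by (simp add: vector_derivative_works)
qed

lemma fst_generatrix_has_derivative:
  assumes "generatrix I \<alpha>" and "s \<in> I"
  shows "((\<lambda>t. fst (\<alpha> t)) has_real_derivative fst (velocity I \<alpha> s)) (at s within I)"
  using bounded_linear.has_vector_derivative[OF bounded_linear_fst generatrix_has_velocity[OF assms]]
  by (simp add: has_real_derivative_iff_has_vector_derivative)

lemma snd_generatrix_has_derivative:
  assumes "generatrix I \<alpha>" and "s \<in> I"
  shows "((\<lambda>t. snd (\<alpha> t)) has_real_derivative momentum I \<alpha> s) (at s within I)"
  using bounded_linear.has_vector_derivative[OF bounded_linear_snd generatrix_has_velocity[OF assms]]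
  by (simp add: has_real_derivative_iff_has_vector_derivative momentum_def inner_prod_def)

lemma fst_velocity_eq_sqrt_momentum:
  assumes "generatrix I \<alpha>" and "x_increasing I \<alpha>" and "s \<in> I"
  shows "fst (velocity I \<alpha> s) = sqrt (1 - (momentum I \<alpha> s)\<^sup>2)"
proof -
  have "norm (velocity I \<alpha> s) = 1" and pos: "fst (velocity I \<alpha> s) > 0"
    using assms by (auto simp: generatrix_def x_increasing_def)
  then have "(fst (velocity I \<alpha> s))\<^sup>2 + (snd (velocity I \<alpha> s))\<^sup>2 = 1"
    by (simp add: norm_prod_def)
  then have "1 - (momentum I \<alpha> s)\<^sup>2 = (fst (velocity I \<alpha> s))\<^sup>2"
    by (simp add: momentum_def inner_prod_def)
  then show ?thesis
    using pos by simp
qed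

lemma x_increasing_imp_inj_on:
  assumes "generatrix I \<alpha>" and "x_increasing I \<alpha>"
  shows "inj_on (\<lambda>s. fst (\<alpha> s)) I"
proof -
  have "strict_mono_on I (\<lambda>s. fst (\<alpha> s))"
    by (rule pos_derivative_within_imp_strict_mono_on[OF _ fst_generatrix_has_derivative[OF assms(1)]])
      (use assms in \<open>auto simp: generatrix_def x_increasing_def\<close>)
  then show ?thesis
    by (rule strict_mono_on_imp_inj_on)
qed

text \<open>
  The chain rule gives \<open>dh/dx = (dz/ds) / (dx/ds)\<close>; unit speed removes the dependence on everything
  but the momentum.
\<close>

lemma height_has_derivative:
  assumes gen: "generatrix I \<alpha>" and inc: "x_increasing I \<alpha>" and r: "r \<in> x_values I \<alpha>"
  shows "(height_of_x I \<alpha> has_real_derivative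
           momentum_of_x I \<alpha> r / sqrt (1 - (momentum_of_x I \<alpha> r)\<^sup>2)) (at r within x_values I \<alpha>)"
proof -
  let ?x = "\<lambda>s. fst (\<alpha> s)"
  let ?g = "the_inv_into I ?x"
  obtain s where s: "s \<in> I" "r = ?x s"
    using r by (auto simp: x_values_def)
  have inj: "inj_on ?x I"
    using gen inc by (rule x_increasing_imp_inj_on)
  have gr: "?g r = s"
    using the_inv_into_f_f[OF inj s(1)] s(2) by simp
  have image: "?g ` x_values I \<alpha> = I"
    using the_inv_into_onto[OF inj] by (simp add: x_values_def)
  have dg: "(?g has_real_derivative inverse (fst (velocity I \<alpha> s))) (at r within x_values I \<alpha>)"
    unfolding x_values_def s(2)
    by (rule has_derivative_the_inv_into_interval[OF _ fst_generatrix_has_derivative[OF gen] _ s(1)])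
      (use gen inc in \<open>auto simp: generatrix_def x_increasing_def\<close>)
  have "((\<lambda>t. snd (\<alpha> t)) has_real_derivative momentum I \<alpha> s) (at (?g r) within ?g ` x_values I \<alpha>)"
    using snd_generatrix_has_derivative[OF gen s(1)] gr image by simp
  from DERIV_image_chain[OF this dg]
  show ?thesis
    using gr fst_velocity_eq_sqrt_momentum[OF gen inc s(1)]
    by (simp add: o_def height_of_x_def[abs_def] momentum_of_x_def divide_inverse)
qed

lemma convex_x_values:
  assumes "generatrix I \<alpha>"
  shows "convex (x_values I \<alpha>)"
proof -
  have "continuous_on I (\<lambda>s. fst (\<alpha> s))"
    by (rule DERIV_continuous_on[OF fst_generatrix_has_derivative[OF assms]])
  moreover have "connected I"
    using assms by (simp add: generatrix_def is_interval_connected)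
  ultimately show ?thesis
    unfolding x_values_def by (simp add: connected_continuous_image flip: connected_convex_1)
qed

lemma rotational_surface_eq_height_graph:
  assumes "generatrix I \<alpha>" and "x_increasing I \<alpha>"
  shows "rotational_surface I \<alpha> =
           (\<lambda>(r, \<theta>). vector [r * cos \<theta>, r * sin \<theta>, height_of_x I \<alpha> r]) ` (x_values I \<alpha> \<times> UNIV)"
proof -
  define G where "G r \<theta> = (vector [r * cos \<theta>, r * sin \<theta>, height_of_x I \<alpha> r] :: real ^ 3)" for r \<theta>
  have "rotational_param \<alpha> s \<theta> = G (fst (\<alpha> s)) \<theta>" if "s \<in> I" for s \<theta>
    using the_inv_into_f_f[OF x_increasing_imp_inj_on[OF assms] that]
    by (simp add: G_def rotational_param_def height_of_x_def)
  then have "rotational_surface I \<alpha> = {G (fst (\<alpha> s)) \<theta> | s \<theta>. s \<in> I}"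
    unfolding rotational_surface_def by metis
  also have "\<dots> = (\<lambda>(r, \<theta>). G r \<theta>) ` (x_values I \<alpha> \<times> UNIV)"
    unfolding x_values_def by force
  finally show ?thesis
    unfolding G_def .
qed

theorem corollary3p1:
  fixes \<alpha> \<beta> :: "real \<Rightarrow> real \<times> real" and I J :: "real set"
  assumes "generatrix I \<alpha>" and "x_increasing I \<alpha>"
    and "generatrix J \<beta>" and "x_increasing J \<beta>"
    and "x_values I \<alpha> = x_values J \<beta>"
    and "\<forall>r \<in> x_values I \<alpha>. momentum_of_x I \<alpha> r = momentum_of_x J \<beta> r"
  shows "\<exists>c :: real. rotational_surface J \<beta> = (\<lambda>p. p + vector [0, 0, c]) ` rotational_surface I \<alpha>"
proof -
  let ?X = "x_values I \<alpha>"
  let ?h = "height_of_x I \<alpha>" and ?k = "height_of_x J \<beta>"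
  have deriv: "((\<lambda>r. ?k r - ?h r) has_real_derivative 0) (at r within ?X)" if r: "r \<in> ?X" for r
  proof -
    let ?d = "momentum_of_x I \<alpha> r / sqrt (1 - (momentum_of_x I \<alpha> r)\<^sup>2)"
    have "(?h has_real_derivative ?d) (at r within ?X)"
      by (rule height_has_derivative[OF assms(1,2) r])
    moreover have "(?k has_real_derivative ?d) (at r within ?X)"
      using height_has_derivative[OF assms(3,4) r[unfolded assms(5)]]
      unfolding assms(5)[symmetric] bspec[OF assms(6) r, symmetric] .
    ultimately show ?thesis
      using DERIV_diff[of ?k ?d r ?X ?h ?d] by simp
  qed
  obtain c where c: "\<forall>r\<in>?X. ?k r - ?h r = c"
    using has_field_derivative_zero_constant[OF convex_x_values[OF assms(1)] deriv] by blast
  have translate: "vector [r * cos \<theta>, r * sin \<theta>, height_of_x J \<beta> r] =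
      (vector [r * cos \<theta>, r * sin \<theta>, height_of_x I \<alpha> r] + vector [0, 0, c] :: real ^ 3)"
    if "r \<in> ?X" for r \<theta>
    using bspec[OF c that] by (simp add: vec_eq_iff forall_3 algebra_simps)
  have "rotational_surface J \<beta> = (\<lambda>p. p + vector [0, 0, c]) ` rotational_surface I \<alpha>"
    unfolding rotational_surface_eq_height_graph[OF assms(1,2)]
      rotational_surface_eq_height_graph[OF assms(3,4)] assms(5)[symmetric] image_image
    by (rule image_cong[OF refl]) (clarsimp simp: translate)
  then show ?thesis
    by (rule exI)
qed

end
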